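(* Let $J$ be a unital JB$^*$-algebra and let $T : J \to J$ be a (bounded linear) local triple derivation. Then $T$ is a triple derivation.
   Context: A JB$^*$-algebra is a complex Banach space $J$ which is a complex Jordan algebra with product $\circ$ satisfying $\|a\circ b\| \le \|a\|\,\|b\|$, equipped with a conjugate-linear algebra involution $^*$, such that $\|\{a,a,a\}\| = \|a\|^3$ for all $a \in J$, where the triple product on $J$ is $\{a,b,c\} := (a\circ b^* )\circ c + (c\circ b^* )\circ a - (a\circ c)\circ b^*$. A (complex) linear map $\delta : J \to J$ is a triple derivation if $\delta\{a,b,c\} = \{\delta(a),b,c\} + \{a,\delta(b),c\} + \{a,b,\delta(c)\}$ for all $a,b,c\in J$. A bounded linear operator $T : J \to J$ is a local triple derivation if for each $a \in J$ there exists a triple derivation $\delta_a : J \to J$ (depending on $a$) with $T(a) = \delta_a(a)$. *)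

theory Defs
  imports "HOL-Analysis.Analysis"
begin

text \<open>
  The complex scalar multiplication is a parameter \<open>scaleC\<close>, required to extend the real scalar
  multiplication of the type and to make the norm complex-homogeneous.  Over a type of class
  \<open>banach\<close> this amounts to a complex Banach space.
\<close>

locale complex_banach_space = vector_space scaleC
  for scaleC :: "complex \<Rightarrow> 'a::banach \<Rightarrow> 'a" (infixr \<open>*\<^sub>c\<close> 75) +
  assumes scale_of_real: "complex_of_real r *\<^sub>c x = r *\<^sub>R x"
    and norm_scale: "norm (c *\<^sub>c x) = cmod c * norm x"

locale complex_jordan_algebra = vector_space scaleC
  for scaleC :: "complex \<Rightarrow> 'a::ab_group_add \<Rightarrow> 'a" (infixr \<open>*\<^sub>c\<close> 75) +
  fixes jprod :: "'a \<Rightarrow> 'a \<Rightarrow> 'a" (infixl \<open>\<bullet>\<^sub>J\<close> 70)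
  assumes jprod_commute: "a \<bullet>\<^sub>J b = b \<bullet>\<^sub>J a"
    and jprod_add_left: "(a + b) \<bullet>\<^sub>J c = a \<bullet>\<^sub>J c + b \<bullet>\<^sub>J c"
    and jprod_scale_left: "(z *\<^sub>c a) \<bullet>\<^sub>J b = z *\<^sub>c (a \<bullet>\<^sub>J b)"
    and jordan_identity: "(a \<bullet>\<^sub>J b) \<bullet>\<^sub>J (a \<bullet>\<^sub>J a) = a \<bullet>\<^sub>J (b \<bullet>\<^sub>J (a \<bullet>\<^sub>J a))"

definition triple_product ::
    "('a::ab_group_add \<Rightarrow> 'a \<Rightarrow> 'a) \<Rightarrow> ('a \<Rightarrow> 'a) \<Rightarrow> 'a \<Rightarrow> 'a \<Rightarrow> 'a \<Rightarrow> 'a" where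
  "triple_product jprod star a b c =
     jprod (jprod a (star b)) c + jprod (jprod c (star b)) a - jprod (jprod a c) (star b)"

locale jb_star_algebra =
  complex_banach_space scaleC + complex_jordan_algebra scaleC jprod
  for scaleC :: "complex \<Rightarrow> 'a::banach \<Rightarrow> 'a" (infixr \<open>*\<^sub>c\<close> 75)
    and jprod :: "'a \<Rightarrow> 'a \<Rightarrow> 'a" (infixl \<open>\<bullet>\<^sub>J\<close> 70) +
  fixes star :: "'a \<Rightarrow> 'a"
  assumes norm_jprod_le: "norm (a \<bullet>\<^sub>J b) \<le> norm a * norm b"
    and star_add: "star (a + b) = star a + star b"
    and star_scale: "star (z *\<^sub>c a) = cnj z *\<^sub>c star a"
    and star_star: "star (star a) = a"
    and star_jprod: "star (a \<bullet>\<^sub>J b) = star b \<bullet>\<^sub>J star a"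
    and norm_triple: "norm (triple_product jprod star a a a) = norm a ^ 3"

locale unital_jb_star_algebra = jb_star_algebra scaleC jprod star
  for scaleC :: "complex \<Rightarrow> 'a::banach \<Rightarrow> 'a" (infixr \<open>*\<^sub>c\<close> 75)
    and jprod :: "'a \<Rightarrow> 'a \<Rightarrow> 'a" (infixl \<open>\<bullet>\<^sub>J\<close> 70)
    and star :: "'a \<Rightarrow> 'a" +
  fixes unit :: 'a
  assumes unit_jprod: "unit \<bullet>\<^sub>J a = a"

definition triple_derivation ::
    "(complex \<Rightarrow> 'a::ab_group_add \<Rightarrow> 'a) \<Rightarrow> ('a \<Rightarrow> 'a \<Rightarrow> 'a) \<Rightarrow> ('a \<Rightarrow> 'a) \<Rightarrow> ('a \<Rightarrow> 'a) \<Rightarrow> bool" where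
  "triple_derivation scaleC jprod star \<delta> \<longleftrightarrow>
     Vector_Spaces.linear scaleC scaleC \<delta> \<and>
     (\<forall>a b c. \<delta> (triple_product jprod star a b c) =
        triple_product jprod star (\<delta> a) b c + triple_product jprod star a (\<delta> b) c
        + triple_product jprod star a b (\<delta> c))"

text \<open>
  \<open>bounded_linear\<close> only says real-linear and bounded; complex linearity is the first conjunct.
  The derivations \<open>\<delta>\<close> are not required to be bounded.
\<close>

definition local_triple_derivation ::
    "(complex \<Rightarrow> 'a::real_normed_vector \<Rightarrow> 'a) \<Rightarrow> ('a \<Rightarrow> 'a \<Rightarrow> 'a) \<Rightarrow> ('a \<Rightarrow> 'a) \<Rightarrow> ('a \<Rightarrow> 'a) \<Rightarrow> bool" where
  "local_triple_derivation scaleC jprod star T \<longleftrightarrow>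
     Vector_Spaces.linear scaleC scaleC T \<and> bounded_linear T \<and>
     (\<forall>a. \<exists>\<delta>. triple_derivation scaleC jprod star \<delta> \<and> T a = \<delta> a)"

end

theory Submission
  imports Defs
begin

text \<open>
  Call \<open>u\<close> unitary if \<open>u \<bullet> u\<^sup>* = 1\<close> and the multiplications by \<open>u\<close> and \<open>u\<^sup>*\<close> commute.  Then
  \<open>{x,u,u} = {u,u,x} = x\<close> for all \<open>x\<close>, so applying a triple derivation \<open>\<delta>\<close> to \<open>{u,u,u} = u\<close> leaves
  \<open>{u, \<delta> u, u} = - \<delta> u\<close>.  This identity involves \<open>\<delta>\<close> only through its value at \<open>u\<close>; hence every local
  triple derivation satisfies it at every unitary (\<open>triple_derivation_unitary\<close>).  The proof shows that
  these identities, taken along curves of unitaries through the unit, already force the Leibniz rule.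

  At \<open>u = 1\<close> the identity says that \<open>T 1\<close> is skew.  Multiplication by a skew element is itself a triple
  derivation (\<open>skew_multiplication_triple_derivation\<close>), so subtracting multiplication by \<open>T 1\<close> gives
  a bounded operator \<open>S\<close> with \<open>S 1 = 0\<close> that still satisfies the identity at every unitary.

  For self-adjoint \<open>h\<close> and small real \<open>t\<close> the Cayley transform
  \<open>u = (1 + i t h) (1 - i t h)\<^sup>-\<^sup>1 = 1 + 2 i t h - 2 t\<^sup>2 h\<^sup>2 + O(t\<^sup>3)\<close> is unitary (\<open>unitary_cayley\<close>).  Comparing
  coefficients in \<open>{u, S u, u} = - S u\<close>, the first order gives \<open>(S h)\<^sup>* = S h\<close>, and the second order then
  gives \<open>S (h\<^sup>2) = 2 h \<bullet> S h\<close>.  Polarisation and complex linearity turn this into: \<open>S\<close> commutes with the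
  involution and is a derivation of the Jordan product (\<open>jordan_star_derivation_of_unitaries\<close>).  Since
  the triple product is built from these two operations, \<open>S\<close> is a triple derivation, and so is \<open>T\<close>.

  The inverse \<open>(1 - e)\<^sup>-\<^sup>1\<close> is the Neumann series in the Jordan powers of \<open>e\<close>.  The product being not
  associative, the computations with it rest on one fact: multiplications by powers of \<open>e\<close> and of \<open>- e\<close>
  commute, which is a consequence of the linearized Jordan identity.  The norm axiom for \<open>{a,a,a}\<close>
  gives the continuity of the involution, on which the limits \<open>t \<rightarrow> 0\<close> depend (\<open>norm_star_le\<close>).
\<close>

section \<open>Jordan algebras\<close>

context complex_jordan_algebra
begin

lemma clinear_iff:
  "Vector_Spaces.linear scaleC scaleC f \<longleftrightarrow>
    (\<forall>x y. f (x + y) = f x + f y) \<and> (\<forall>c x. f (c *\<^sub>c x) = c *\<^sub>c f x)"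
  using vector_space_axioms by (simp add: Vector_Spaces.linear_iff)

lemma jprod_add_right: "c \<bullet>\<^sub>J (a + b) = c \<bullet>\<^sub>J a + c \<bullet>\<^sub>J b"
  by (metis jprod_add_left jprod_commute)

lemma jprod_scale_right: "a \<bullet>\<^sub>J (z *\<^sub>c b) = z *\<^sub>c (a \<bullet>\<^sub>J b)"
  by (metis jprod_scale_left jprod_commute)

lemma jprod_zero_left [simp]: "0 \<bullet>\<^sub>J a = 0"
  by (metis jprod_add_left add_cancel_right_right add_0)

lemma jprod_minus_left: "(- a) \<bullet>\<^sub>J b = - (a \<bullet>\<^sub>J b)"
  by (metis jprod_add_left jprod_zero_left add.right_inverse add_eq_0_iff)

lemma jprod_minus_right: "a \<bullet>\<^sub>J (- b) = - (a \<bullet>\<^sub>J b)"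
  by (metis jprod_minus_left jprod_commute)

lemma jprod_diff_left: "(a - b) \<bullet>\<^sub>J c = a \<bullet>\<^sub>J c - b \<bullet>\<^sub>J c"
  using jprod_add_left[of a "- b" c] by (simp add: jprod_minus_left)

lemma jprod_diff_right: "c \<bullet>\<^sub>J (a - b) = c \<bullet>\<^sub>J a - c \<bullet>\<^sub>J b"
  by (metis jprod_diff_left jprod_commute)

lemmas jprod_simps =
  jprod_add_left jprod_add_right jprod_minus_left jprod_minus_right
  jprod_diff_left jprod_diff_right jprod_scale_left jprod_scale_right

text \<open>
  The Jordan identity is cubic in \<open>a\<close>, and this is its polarisation: with \<open>F x y z\<close> the defect of the
  identity, trilinear and symmetric in its last two arguments, inclusion--exclusion on
  \<open>F (a + c + d) (a + c + d) (a + c + d)\<close> leaves the sum over all permutations of \<open>a\<close>, \<open>c\<close>, \<open>d\<close>.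
\<close>

lemma jordan_linearized:
  "(a \<bullet>\<^sub>J b) \<bullet>\<^sub>J (c \<bullet>\<^sub>J d) + (c \<bullet>\<^sub>J b) \<bullet>\<^sub>J (d \<bullet>\<^sub>J a) + (d \<bullet>\<^sub>J b) \<bullet>\<^sub>J (a \<bullet>\<^sub>J c) =
    a \<bullet>\<^sub>J (b \<bullet>\<^sub>J (c \<bullet>\<^sub>J d)) + c \<bullet>\<^sub>J (b \<bullet>\<^sub>J (d \<bullet>\<^sub>J a)) + d \<bullet>\<^sub>J (b \<bullet>\<^sub>J (a \<bullet>\<^sub>J c))"
proof -
  define F where "F x y z = (x \<bullet>\<^sub>J b) \<bullet>\<^sub>J (y \<bullet>\<^sub>J z) - x \<bullet>\<^sub>J (b \<bullet>\<^sub>J (y \<bullet>\<^sub>J z))" for x y z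
  have diag: "F x x x = 0" for x
    by (simp add: F_def jordan_identity)
  have add1: "F (x + x') y z = F x y z + F x' y z"
    and add2: "F x (y + y') z = F x y z + F x y' z"
    and sym: "F x y z = F x z y" for x x' y y' z
    by (simp_all add: F_def jprod_simps jprod_commute[of z y])
  have add3: "F x y (z + z') = F x y z + F x y z'" for x y z z'
    by (metis add2 sym)
  have "(F a c d + F c d a + F d a c) + (F a c d + F c d a + F d a c) =
      F (a + c + d) (a + c + d) (a + c + d) - F (a + c) (a + c) (a + c)
      - F (a + d) (a + d) (a + d) - F (c + d) (c + d) (c + d) + F a a a + F c c c + F d d d"
    by (simp add: add1 add2 add3 sym[of _ d c] sym[of _ c a] sym[of _ d a] algebra_simps)
  then have "(F a c d + F c d a + F d a c) + (F a c d + F c d a + F d a c) = 0"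
    by (simp add: diag)
  then have "(2::complex) *\<^sub>c (F a c d + F c d a + F d a c) = 0"
    using scale_left_distrib[of 1 1 "F a c d + F c d a + F d a c"] by simp
  then have "F a c d + F c d a + F d a c = 0"
    by simp
  then show ?thesis
    by (simp add: F_def algebra_simps)
qed

text \<open>
  With \<open>v = y\<^sup>*\<close> and \<open>a\<close> skew, so that \<open>(a \<bullet> y)\<^sup>* = - (a \<bullet> v)\<close>, this is the Leibniz rule for multiplication by
  \<open>a\<close> on \<open>{x,y,z}\<close>.  The difference of the two sides is a combination of three instances of the
  linearized Jordan identity.
\<close>

lemma jprod_triple_leibniz:
  "a \<bullet>\<^sub>J ((x \<bullet>\<^sub>J v) \<bullet>\<^sub>J z + (z \<bullet>\<^sub>J v) \<bullet>\<^sub>J x - (x \<bullet>\<^sub>J z) \<bullet>\<^sub>J v) =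
    ((a \<bullet>\<^sub>J x) \<bullet>\<^sub>J v) \<bullet>\<^sub>J z + (z \<bullet>\<^sub>J v) \<bullet>\<^sub>J (a \<bullet>\<^sub>J x) - ((a \<bullet>\<^sub>J x) \<bullet>\<^sub>J z) \<bullet>\<^sub>J v
    - ((x \<bullet>\<^sub>J (a \<bullet>\<^sub>J v)) \<bullet>\<^sub>J z + (z \<bullet>\<^sub>J (a \<bullet>\<^sub>J v)) \<bullet>\<^sub>J x - (x \<bullet>\<^sub>J z) \<bullet>\<^sub>J (a \<bullet>\<^sub>J v))
    + ((x \<bullet>\<^sub>J v) \<bullet>\<^sub>J (a \<bullet>\<^sub>J z) + ((a \<bullet>\<^sub>J z) \<bullet>\<^sub>J v) \<bullet>\<^sub>J x - (x \<bullet>\<^sub>J (a \<bullet>\<^sub>J z)) \<bullet>\<^sub>J v)"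
  (is "?l = ?r")
proof -
  define J where "J a b c d =
      (a \<bullet>\<^sub>J b) \<bullet>\<^sub>J (c \<bullet>\<^sub>J d) + (c \<bullet>\<^sub>J b) \<bullet>\<^sub>J (d \<bullet>\<^sub>J a) + (d \<bullet>\<^sub>J b) \<bullet>\<^sub>J (a \<bullet>\<^sub>J c)
      - (a \<bullet>\<^sub>J (b \<bullet>\<^sub>J (c \<bullet>\<^sub>J d)) + c \<bullet>\<^sub>J (b \<bullet>\<^sub>J (d \<bullet>\<^sub>J a)) + d \<bullet>\<^sub>J (b \<bullet>\<^sub>J (a \<bullet>\<^sub>J c)))" for a b c d
  have "?l - ?r = J a v x z - J a x v z - J a z x v"
    by (simp add: J_def jprod_simps algebra_simps jprod_commute)
  then show ?thesis
    by (simp add: J_def jordan_linearized)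
qed

text \<open>
  Reading the linearized identity as a statement about operators acting on \<open>y\<close> expresses multiplication
  by a product of three factors through multiplications by products of at most two of them.  With
  \<open>a = b = e\<close> it becomes a two-step recursion for multiplication by the powers of \<open>e\<close>.
\<close>

lemma jprod_operator_product:
  "(b \<bullet>\<^sub>J (a \<bullet>\<^sub>J c)) \<bullet>\<^sub>J y =
    (a \<bullet>\<^sub>J b) \<bullet>\<^sub>J (c \<bullet>\<^sub>J y) + (c \<bullet>\<^sub>J b) \<bullet>\<^sub>J (a \<bullet>\<^sub>J y) + (a \<bullet>\<^sub>J c) \<bullet>\<^sub>J (b \<bullet>\<^sub>J y)
    - a \<bullet>\<^sub>J (b \<bullet>\<^sub>J (c \<bullet>\<^sub>J y)) - c \<bullet>\<^sub>J (b \<bullet>\<^sub>J (a \<bullet>\<^sub>J y))"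
  using jordan_linearized[of a b c y]
  by (simp add: jprod_commute algebra_simps)

text \<open>
  Multiplications by \<open>a\<close> and \<open>b\<close> commute; in a Jordan algebra this is a genuine restriction on the
  pair, and it replaces associativity in computations.
\<close>

definition op_commute :: "'a \<Rightarrow> 'a \<Rightarrow> bool" where
  "op_commute a b \<longleftrightarrow> (\<forall>y. a \<bullet>\<^sub>J (b \<bullet>\<^sub>J y) = b \<bullet>\<^sub>J (a \<bullet>\<^sub>J y))"

lemma op_commute_sym: "op_commute a b \<Longrightarrow> op_commute b a"
  by (simp add: op_commute_def)

end

section \<open>Continuity of the involution, skew multiplications\<close>

context jb_star_algebra
begin

abbreviation triple :: "'a \<Rightarrow> 'a \<Rightarrow> 'a \<Rightarrow> 'a" where
  "triple \<equiv> triple_product jprod star"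

lemma star_zero [simp]: "star 0 = 0"
  using star_add[of 0 0] by simp

lemma star_minus: "star (- a) = - star a"
  using star_add[of a "- a"] by (simp add: eq_neg_iff_add_eq_0 add.commute)

lemma star_diff: "star (a - b) = star a - star b"
  using star_add[of a "- b"] by (simp add: star_minus)

lemma star_scaleR: "star (r *\<^sub>R a) = r *\<^sub>R star a"
  using star_scale[of "complex_of_real r" a] by (simp add: scale_of_real)

lemma bounded_bilinear_jprod: "bounded_bilinear jprod"
proof
  show "(r *\<^sub>R a) \<bullet>\<^sub>J b = r *\<^sub>R (a \<bullet>\<^sub>J b)" "a \<bullet>\<^sub>J (r *\<^sub>R b) = r *\<^sub>R (a \<bullet>\<^sub>J b)" for r a b
    using jprod_scale_left[of "complex_of_real r" a b] jprod_scale_right[of a "complex_of_real r" b]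
    by (simp_all add: scale_of_real)
  show "\<exists>K. \<forall>a b. norm (a \<bullet>\<^sub>J b) \<le> norm a * norm b * K"
    by (rule exI[of _ 1]) (simp add: norm_jprod_le)
qed (simp_all add: jprod_add_left jprod_add_right)

text \<open>
  The axiom gives \<open>\<parallel>b\<parallel>\<^sup>3 = \<parallel>{b,b,b}\<parallel> \<le> 3 \<parallel>b\<parallel>\<^sup>2 \<parallel>b\<^sup>*\<parallel>\<close>; take \<open>b = a\<^sup>*\<close>.
\<close>

lemma norm_star_le: "norm (star a) \<le> 3 * norm a"
proof (cases "a = 0")
  case False
  let ?b = "star a"
  have b: "norm ?b > 0"
    using False by (metis star_star star_zero zero_less_norm_iff)
  have "norm ((?b \<bullet>\<^sub>J star ?b) \<bullet>\<^sub>J ?b) \<le> norm ?b * norm (star ?b) * norm ?b"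
    and "norm ((?b \<bullet>\<^sub>J ?b) \<bullet>\<^sub>J star ?b) \<le> norm ?b * norm ?b * norm (star ?b)"
    by (meson norm_jprod_le norm_ge_zero order_trans mult_right_mono)+
  moreover have "norm (triple ?b ?b ?b) \<le> norm ((?b \<bullet>\<^sub>J star ?b) \<bullet>\<^sub>J ?b)
      + norm ((?b \<bullet>\<^sub>J star ?b) \<bullet>\<^sub>J ?b) + norm ((?b \<bullet>\<^sub>J ?b) \<bullet>\<^sub>J star ?b)"
    unfolding triple_product_def by (meson norm_triangle_ineq norm_triangle_ineq4 order_trans add_right_mono)
  ultimately have "norm ?b ^ 3 \<le> norm ?b ^ 2 * (3 * norm a)"
    by (simp add: norm_triple star_star power2_eq_square mult_ac)
  then have "norm ?b ^ 2 * norm ?b \<le> norm ?b ^ 2 * (3 * norm a)"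
    by (simp add: power3_eq_cube power2_eq_square mult.assoc)
  then show ?thesis
    using b by simp
qed simp

lemma bounded_linear_star: "bounded_linear star"
  by (rule bounded_linear_intro[where K = 3])
    (simp_all add: star_add star_scaleR norm_star_le mult.commute[of _ 3])

lemma op_commute_sums:
  assumes "f sums a" and "\<And>n. op_commute (f n) b"
  shows "op_commute a b"
  unfolding op_commute_def
proof
  fix y
  note bl = bounded_bilinear_jprod
  have "(\<lambda>n. f n \<bullet>\<^sub>J (b \<bullet>\<^sub>J y)) sums (a \<bullet>\<^sub>J (b \<bullet>\<^sub>J y))"
    by (rule bounded_linear.sums[OF bounded_bilinear.bounded_linear_left[OF bl] assms(1)])
  moreover have "(\<lambda>n. b \<bullet>\<^sub>J (f n \<bullet>\<^sub>J y)) sums (b \<bullet>\<^sub>J (a \<bullet>\<^sub>J y))"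
    by (intro bounded_linear.sums[OF bounded_bilinear.bounded_linear_right[OF bl]]
        bounded_linear.sums[OF bounded_bilinear.bounded_linear_left[OF bl]] assms(1))
  ultimately show "a \<bullet>\<^sub>J (b \<bullet>\<^sub>J y) = b \<bullet>\<^sub>J (a \<bullet>\<^sub>J y)"
    using assms(2) by (simp add: op_commute_def sums_unique2)
qed

lemma skew_multiplication_triple_derivation:
  assumes "star a = - a"
  shows "triple_derivation scaleC jprod star (jprod a)"
proof -
  have "Vector_Spaces.linear scaleC scaleC (jprod a)"
    by unfold_locales (simp_all add: jprod_simps)
  moreover have "star (a \<bullet>\<^sub>J y) = - (a \<bullet>\<^sub>J star y)" for y
    by (simp add: star_jprod assms jprod_minus_right jprod_commute[of "star y"])
  then have "a \<bullet>\<^sub>J triple x y z = triple (a \<bullet>\<^sub>J x) y z + triple x (a \<bullet>\<^sub>J y) z + triple x y (a \<bullet>\<^sub>J z)"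
    for x y z
    unfolding triple_product_def jprod_triple_leibniz
    by (simp add: jprod_minus_left jprod_minus_right)
  ultimately show ?thesis
    by (simp add: triple_derivation_def)
qed

end

section \<open>Jordan powers, the Neumann series and Cayley unitaries\<close>

fun jordan_power :: "('a \<Rightarrow> 'a \<Rightarrow> 'a) \<Rightarrow> 'a \<Rightarrow> 'a \<Rightarrow> nat \<Rightarrow> 'a" where
  "jordan_power jprod unit e 0 = unit"
| "jordan_power jprod unit e (Suc n) = jprod e (jordan_power jprod unit e n)"

context unital_jb_star_algebra
begin

abbreviation jpow :: "'a \<Rightarrow> nat \<Rightarrow> 'a" where
  "jpow \<equiv> jordan_power jprod unit"

declare unit_jprod [simp]

lemma jprod_unit [simp]: "a \<bullet>\<^sub>J unit = a"
  by (subst jprod_commute) (rule unit_jprod)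

text \<open>
  By the recursion for multiplication by powers, that operator is a polynomial in multiplication by
  \<open>e\<close> and by \<open>e \<bullet> e\<close>, so an additive map commuting with these two commutes with it.
\<close>

lemma commutes_with_jpow:
  assumes add: "\<And>x y. X (x + y) = X x + X y"
    and e: "\<And>y. X (e \<bullet>\<^sub>J y) = e \<bullet>\<^sub>J X y"
    and ee: "\<And>y. X ((e \<bullet>\<^sub>J e) \<bullet>\<^sub>J y) = (e \<bullet>\<^sub>J e) \<bullet>\<^sub>J X y"
  shows "X (jpow e n \<bullet>\<^sub>J y) = jpow e n \<bullet>\<^sub>J X y"
proof -
  interpret X: additive X
    by unfold_locales (rule add)
  show ?thesis
  proof (induction n arbitrary: y rule: induct_nat_012)
    case 0
    show ?case by simp
  next
    case 1
    show ?case by (simp add: e)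
  next
    case (ge2 n)
    have op: "jpow e (Suc (Suc n)) \<bullet>\<^sub>J y =
        (e \<bullet>\<^sub>J e) \<bullet>\<^sub>J (jpow e n \<bullet>\<^sub>J y) + jpow e (Suc n) \<bullet>\<^sub>J (e \<bullet>\<^sub>J y) + jpow e (Suc n) \<bullet>\<^sub>J (e \<bullet>\<^sub>J y)
        - e \<bullet>\<^sub>J (e \<bullet>\<^sub>J (jpow e n \<bullet>\<^sub>J y)) - jpow e n \<bullet>\<^sub>J (e \<bullet>\<^sub>J (e \<bullet>\<^sub>J y))" for y
      using jprod_operator_product[of e e "jpow e n" y]
      by (simp add: jprod_commute[of "jpow e n" e])
    show ?case
      unfolding op X.add X.diff by (simp only: ge2 e ee)
  qed
qed

text \<open>
  The Jordan identity makes multiplication by \<open>e\<close> and by \<open>e \<bullet> e\<close> commute, so both commute with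
  multiplication by each power of \<open>e\<close>.  The latter therefore commutes with multiplication by \<open>- e\<close> and
  \<open>(- e) \<bullet> (- e) = e \<bullet> e\<close>, hence with multiplication by the powers of \<open>- e\<close>.
\<close>

lemma op_commute_jpow_minus: "op_commute (jpow e m) (jpow (- e) n)"
proof -
  have ee: "(- e) \<bullet>\<^sub>J (- e) = e \<bullet>\<^sub>J e"
    by (simp add: jprod_minus_left jprod_minus_right)
  have jordan: "e \<bullet>\<^sub>J ((e \<bullet>\<^sub>J e) \<bullet>\<^sub>J y) = (e \<bullet>\<^sub>J e) \<bullet>\<^sub>J (e \<bullet>\<^sub>J y)" for y
    by (metis jordan_identity jprod_commute)
  have "e \<bullet>\<^sub>J (jpow e m \<bullet>\<^sub>J y) = jpow e m \<bullet>\<^sub>J (e \<bullet>\<^sub>J y)" for y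
    by (rule commutes_with_jpow[where X = "jprod e"]) (simp_all add: jprod_add_right jordan)
  moreover have "(e \<bullet>\<^sub>J e) \<bullet>\<^sub>J (jpow e m \<bullet>\<^sub>J y) = jpow e m \<bullet>\<^sub>J ((e \<bullet>\<^sub>J e) \<bullet>\<^sub>J y)" for y
    by (rule commutes_with_jpow[where X = "jprod (e \<bullet>\<^sub>J e)"]) (simp_all add: jprod_add_right jordan)
  ultimately have "jpow e m \<bullet>\<^sub>J (jpow (- e) n \<bullet>\<^sub>J y) = jpow (- e) n \<bullet>\<^sub>J (jpow e m \<bullet>\<^sub>J y)" for y
    by (intro commutes_with_jpow[where X = "jprod (jpow e m)"]) (simp_all add: jprod_add_right jprod_minus_left jprod_minus_right ee)
  then show ?thesis
    by (simp add: op_commute_def)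
qed

lemma star_unit [simp]: "star unit = unit"
proof -
  have "star (star unit \<bullet>\<^sub>J unit) = star unit \<bullet>\<^sub>J star (star unit)"
    by (rule star_jprod)
  also have "\<dots> = star unit"
    by (simp only: star_star jprod_unit)
  finally show ?thesis
    by (simp only: star_star jprod_unit)
qed

lemma star_jpow: "star (jpow e n) = jpow (star e) n"
  by (induction n) (simp_all add: star_jprod jprod_commute[of "jpow (star e) _"])

lemma norm_jpow_le: "norm (jpow e n) \<le> norm e ^ n * norm unit"
proof (induction n)
  case (Suc n)
  have "norm (jpow e (Suc n)) \<le> norm e * norm (jpow e n)"
    by (simp add: norm_jprod_le)
  also have "\<dots> \<le> norm e * (norm e ^ n * norm unit)"
    by (rule mult_left_mono[OF Suc]) simp
  finally show ?case by (simp add: mult.assoc)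
qed simp

text \<open>The inverse of \<open>1 - e\<close> when \<open>\<parallel>e\<parallel> < 1\<close>.\<close>

definition neumann :: "'a \<Rightarrow> 'a" where
  "neumann e = (\<Sum>n. jpow e n)"

lemma neumann_sums:
  assumes "norm e < 1"
  shows "jpow e sums neumann e"
proof -
  have "summable (\<lambda>n. norm e ^ n * norm unit)"
    by (rule summable_mult2[OF summable_geometric]) (simp add: assms)
  then have "summable (jpow e)"
    by (rule summable_comparison_test'[where N = 0]) (rule norm_jpow_le)
  then show ?thesis
    unfolding neumann_def by (rule summable_sums)
qed

lemma neumann_eq:
  assumes "norm e < 1"
  shows "neumann e = unit + e \<bullet>\<^sub>J neumann e"
proof -
  have "(\<lambda>n. e \<bullet>\<^sub>J jpow e n) sums (e \<bullet>\<^sub>J neumann e)"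
    by (rule bounded_linear.sums
        [OF bounded_bilinear.bounded_linear_right[OF bounded_bilinear_jprod] neumann_sums[OF assms]])
  then have "(\<lambda>n. jpow e (Suc n)) sums (e \<bullet>\<^sub>J neumann e)"
    by (simp only: jordan_power.simps)
  then have "jpow e sums (e \<bullet>\<^sub>J neumann e + jpow e 0)"
    by (rule sums_Suc)
  with neumann_sums[OF assms] have "neumann e = e \<bullet>\<^sub>J neumann e + jpow e 0"
    by (rule sums_unique2)
  also have "\<dots> = unit + e \<bullet>\<^sub>J neumann e"
    by (simp only: jordan_power.simps add.commute)
  finally show ?thesis .
qed

lemma norm_neumann_le:
  assumes "norm e \<le> 1 / 2"
  shows "norm (neumann e) \<le> 2 * norm unit"
proof -
  have "norm (neumann e) = norm (unit + e \<bullet>\<^sub>J neumann e)"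
    by (rule arg_cong[where f = norm], rule neumann_eq) (use assms in simp)
  also have "\<dots> \<le> norm unit + norm (e \<bullet>\<^sub>J neumann e)"
    by (rule norm_triangle_ineq)
  also have "norm (e \<bullet>\<^sub>J neumann e) \<le> 1 / 2 * norm (neumann e)"
    by (rule order_trans[OF norm_jprod_le mult_right_mono[OF assms]]) simp
  finally show ?thesis by simp
qed

lemma star_neumann:
  assumes "norm e < 1" and "star e = - e"
  shows "star (neumann e) = neumann (- e)"
proof -
  have "(\<lambda>n. star (jpow e n)) sums star (neumann e)"
    by (rule bounded_linear.sums[OF bounded_linear_star neumann_sums[OF assms(1)]])
  then have "jpow (- e) sums star (neumann e)"
    by (simp add: star_jpow assms(2))
  then show ?thesis
    by (rule sums_unique2) (rule neumann_sums, use assms(1) in simp)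
qed

lemma op_commute_neumann_minus:
  assumes "norm e < 1"
  shows "op_commute (neumann e) (neumann (- e))"
proof -
  have "op_commute (neumann e) (jpow (- e) n)" for n
    using neumann_sums[OF assms] op_commute_jpow_minus by (rule op_commute_sums)
  then have comm: "op_commute (jpow (- e) n) (neumann e)" for n
    by (rule op_commute_sym)
  have "jpow (- e) sums neumann (- e)"
    by (rule neumann_sums) (use assms in simp)
  then have "op_commute (neumann (- e)) (neumann e)"
    using comm by (rule op_commute_sums)
  then show ?thesis
    by (rule op_commute_sym)
qed

text \<open>
  Commutation is imposed together with \<open>u \<bullet> u\<^sup>* = 1\<close> because the two conditions together give
  \<open>{x,u,u} = x\<close> for every \<open>x\<close>.
\<close>

definition unitary :: "'a \<Rightarrow> bool" where
  "unitary u \<longleftrightarrow> u \<bullet>\<^sub>J star u = unit \<and> op_commute u (star u)"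

text \<open>
  With \<open>r = (1 - e)\<^sup>-\<^sup>1\<close> and \<open>s = (1 + e)\<^sup>-\<^sup>1 = r\<^sup>*\<close>, the Cayley transform \<open>(1 + e) (1 - e)\<^sup>-\<^sup>1\<close> is
  \<open>2 r - 1\<close>, and \<open>(2 r - 1) (2 s - 1) = 1\<close> means \<open>2 r s = r + s\<close>.  That follows by adding
  \<open>r s = s + (e r) s\<close> and \<open>r s = r - r (e s)\<close>: the two cubic terms agree because multiplications by
  \<open>r\<close> and \<open>s\<close> commute.
\<close>

lemma unitary_cayley:
  assumes e: "norm e < 1" "star e = - e"
  shows "unitary (neumann e + neumann e - unit)"
proof -
  let ?r = "neumann e" and ?s = "neumann (- e)"
  have star: "star (?r + ?r - unit) = ?s + ?s - unit"
    by (simp add: star_add star_diff star_neumann[OF e])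
  have comm: "?r \<bullet>\<^sub>J (?s \<bullet>\<^sub>J y) = ?s \<bullet>\<^sub>J (?r \<bullet>\<^sub>J y)" for y
    using op_commute_neumann_minus[OF e(1)] by (simp add: op_commute_def)
  have r: "?r = unit + e \<bullet>\<^sub>J ?r"
    using e(1) by (rule neumann_eq)
  have "?s = unit + (- e) \<bullet>\<^sub>J ?s"
    by (rule neumann_eq) (use e(1) in simp)
  then have s: "?s = unit - e \<bullet>\<^sub>J ?s"
    by (simp only: jprod_minus_left diff_conv_add_uminus)
  have "?r \<bullet>\<^sub>J ?s = ?s + (e \<bullet>\<^sub>J ?r) \<bullet>\<^sub>J ?s"
    by (subst (1) r) (simp add: jprod_add_left)
  moreover have "?r \<bullet>\<^sub>J ?s = ?r - ?r \<bullet>\<^sub>J (e \<bullet>\<^sub>J ?s)"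
    by (subst (1) s) (simp add: jprod_diff_right)
  moreover have "?r \<bullet>\<^sub>J (e \<bullet>\<^sub>J ?s) = (e \<bullet>\<^sub>J ?r) \<bullet>\<^sub>J ?s"
    using comm[of e] by (simp add: jprod_commute)
  ultimately have "?r \<bullet>\<^sub>J ?s + ?r \<bullet>\<^sub>J ?s =
      (?s + (e \<bullet>\<^sub>J ?r) \<bullet>\<^sub>J ?s) + (?r - (e \<bullet>\<^sub>J ?r) \<bullet>\<^sub>J ?s)"
    by metis
  then have sum: "?r \<bullet>\<^sub>J ?s + ?r \<bullet>\<^sub>J ?s - (?r + ?s) = 0"
    by simp
  have "(?r + ?r - unit) \<bullet>\<^sub>J (?s + ?s - unit) =
      (?r \<bullet>\<^sub>J ?s + ?r \<bullet>\<^sub>J ?s - (?r + ?s)) + (?r \<bullet>\<^sub>J ?s + ?r \<bullet>\<^sub>J ?s - (?r + ?s)) + unit"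
    by (simp add: jprod_add_left jprod_add_right jprod_diff_left jprod_diff_right)
  then have "(?r + ?r - unit) \<bullet>\<^sub>J (?s + ?s - unit) = unit"
    by (simp only: sum) simp
  moreover have "op_commute (?r + ?r - unit) (?s + ?s - unit)"
    by (simp add: op_commute_def jprod_add_left jprod_add_right jprod_diff_left jprod_diff_right
        comm)
  ultimately show ?thesis
    by (simp add: unitary_def star)
qed

lemma triple_derivation_unitary:
  assumes "triple_derivation scaleC jprod star \<delta>" and "unitary u"
  shows "triple u (\<delta> u) u = - \<delta> u"
proof -
  have uu: "u \<bullet>\<^sub>J star u = unit" and comm: "u \<bullet>\<^sub>J (star u \<bullet>\<^sub>J y) = star u \<bullet>\<^sub>J (u \<bullet>\<^sub>J y)" for y
    using assms(2) by (simp_all add: unitary_def op_commute_def)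
  have right: "triple x u u = x" for x
    using comm[of x] by (simp add: triple_product_def uu) (simp add: jprod_commute)
  have left: "triple u u x = x" for x
    using comm[of x] by (simp add: triple_product_def uu) (simp add: jprod_commute)
  have "\<delta> (triple u u u) = triple (\<delta> u) u u + triple u (\<delta> u) u + triple u u (\<delta> u)"
    using assms(1) by (simp add: triple_derivation_def)
  then show ?thesis
    by (simp add: left right eq_neg_iff_add_eq_0 add.commute)
qed

section \<open>Jordan derivations from unitaries\<close>

text \<open>
  The identity at the Cayley transform \<open>u\<close> of \<open>e = i t h\<close>, written as \<open>u = 1 + t v\<close> and divided by \<open>t\<close>.
  Since \<open>(1 - e)\<^sup>-\<^sup>1 = 1 + e + e (e (1 - e)\<^sup>-\<^sup>1)\<close>, the expansion stops exactly after the second order, with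
  the remainder in \<open>z\<close>; as \<open>t\<close> tends to 0, \<open>z\<close> tends to \<open>h \<bullet> h\<close> and \<open>v\<close> to \<open>2 i h\<close>.
\<close>

lemma unitary_curve_identity:
  assumes lin: "bounded_linear S" and unit: "S unit = 0"
    and unitary: "\<And>u. unitary u \<Longrightarrow> triple u (S u) u = - S u"
    and h: "star h = h" and t: "\<bar>t\<bar> * norm h \<le> 1 / 2" "t \<noteq> 0"
  defines "z \<equiv> h \<bullet>\<^sub>J (h \<bullet>\<^sub>J neumann (t *\<^sub>R (\<i> *\<^sub>c h)))"
  defines "v \<equiv> (2 * \<i>) *\<^sub>c h - (2 * t) *\<^sub>R z"
  defines "y \<equiv> star (S v)"
  shows "y + (2 * t) *\<^sub>R (v \<bullet>\<^sub>J y) + (t ^ 2) *\<^sub>R (2 *\<^sub>R (v \<bullet>\<^sub>J (v \<bullet>\<^sub>J y)) - (v \<bullet>\<^sub>J v) \<bullet>\<^sub>J y) = - S v"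
proof -
  interpret S: bounded_linear S by (rule lin)
  interpret J: bounded_bilinear jprod by (rule bounded_bilinear_jprod)
  define e where "e = t *\<^sub>R (\<i> *\<^sub>c h)"
  let ?r = "neumann e"
  have norm_e: "norm e < 1"
    using t(1) by (simp add: e_def norm_scale)
  have star_e: "star e = - e"
    by (simp add: e_def star_scaleR star_scale h)
  have e_eq: "e = (t * \<i>) *\<^sub>c h"
    by (simp add: e_def flip: scale_of_real)
  have r: "?r = unit + e \<bullet>\<^sub>J ?r"
    using norm_e by (rule neumann_eq)
  have "?r = unit + (e + e \<bullet>\<^sub>J (e \<bullet>\<^sub>J ?r))"
    by (subst r, subst r) (simp only: J.add_right jprod_unit)
  moreover have "e \<bullet>\<^sub>J (e \<bullet>\<^sub>J ?r) = - (t ^ 2) *\<^sub>R z"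
    unfolding z_def e_def[symmetric]
    by (simp add: e_eq jprod_simps power2_eq_square mult_ac flip: scale_of_real)
  ultimately have "?r = unit + (e + - (t ^ 2) *\<^sub>R z)"
    by simp
  then have "?r + ?r - unit = unit + (2 *\<^sub>R e - (2 * t ^ 2) *\<^sub>R z)"
    by (simp add: scaleR_2 flip: scaleR_scaleR)
  also have "2 *\<^sub>R e - (2 * t ^ 2) *\<^sub>R z = t *\<^sub>R v"
    by (simp add: v_def e_eq scale_right_diff_distrib power2_eq_square mult_ac flip: scale_of_real)
  finally have u: "?r + ?r - unit = unit + t *\<^sub>R v" .
  have Su: "S (unit + t *\<^sub>R v) = t *\<^sub>R S v"
    by (simp add: S.add S.scaleR unit)
  have "triple (unit + t *\<^sub>R v) (S (unit + t *\<^sub>R v)) (unit + t *\<^sub>R v) = - S (unit + t *\<^sub>R v)"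
    using unitary[OF unitary_cayley[OF norm_e star_e]] by (simp only: u)
  moreover have "triple (unit + t *\<^sub>R v) (S (unit + t *\<^sub>R v)) (unit + t *\<^sub>R v) =
      t *\<^sub>R (y + (2 * t) *\<^sub>R (v \<bullet>\<^sub>J y) + (t ^ 2) *\<^sub>R (2 *\<^sub>R (v \<bullet>\<^sub>J (v \<bullet>\<^sub>J y)) - (v \<bullet>\<^sub>J v) \<bullet>\<^sub>J y))"
    unfolding triple_product_def Su star_scaleR y_def[symmetric]
    by (simp add: J.add_left J.add_right J.scaleR_left J.scaleR_right jprod_commute[of y]
        jprod_commute[of "v \<bullet>\<^sub>J y" v] scaleR_add_right scaleR_diff_right scaleR_2
        power2_eq_square mult_ac flip: scaleR_scaleR)
  ultimately have "t *\<^sub>R (y + (2 * t) *\<^sub>R (v \<bullet>\<^sub>J y)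
      + (t ^ 2) *\<^sub>R (2 *\<^sub>R (v \<bullet>\<^sub>J (v \<bullet>\<^sub>J y)) - (v \<bullet>\<^sub>J v) \<bullet>\<^sub>J y)) = t *\<^sub>R (- S v)"
    by (simp only: Su scaleR_minus_right)
  then show ?thesis
    by (rule real_vector.scale_left_imp_eq[OF t(2)])
qed

lemma neumann_tendsto_unit:
  "((\<lambda>t. neumann (t *\<^sub>R a)) \<longlongrightarrow> unit) (at 0)"
proof -
  have zero: "((\<lambda>t. \<bar>t\<bar> * norm a) \<longlongrightarrow> 0) (at (0::real))"
    by (rule tendsto_eq_intros refl | simp)+
  have small: "\<forall>\<^sub>F t in at 0. \<bar>t\<bar> * norm a < 1 / 2"
    by (rule order_tendstoD[OF zero]) simp
  have "\<forall>\<^sub>F t in at 0. norm (neumann (t *\<^sub>R a) - unit) \<le> \<bar>t\<bar> * norm a * (2 * norm unit)"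
    using small
  proof eventually_elim
    case (elim t)
    let ?e = "t *\<^sub>R a"
    have e: "norm ?e < 1" "norm ?e \<le> 1 / 2"
      using elim by simp_all
    have "neumann ?e - unit = ?e \<bullet>\<^sub>J neumann ?e"
      using neumann_eq[OF e(1)] by (metis add_diff_cancel_left')
    then have "norm (neumann ?e - unit) \<le> norm ?e * norm (neumann ?e)"
      by (simp only: norm_jprod_le)
    also have "\<dots> \<le> norm ?e * (2 * norm unit)"
      by (intro mult_left_mono norm_neumann_le e) simp
    finally show ?case by simp
  qed
  moreover have "((\<lambda>t. \<bar>t\<bar> * norm a * (2 * norm unit)) \<longlongrightarrow> 0) (at 0)"
    using tendsto_mult_left_zero[OF zero] by simp
  ultimately have "((\<lambda>t. neumann (t *\<^sub>R a) - unit) \<longlongrightarrow> 0) (at 0)"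
    by (rule Lim_null_comparison)
  then show ?thesis
    by (rule LIM_zero_cancel)
qed

lemma self_adjoint_parts:
  obtains x y where "star x = x" "star y = y" "a = x + \<i> *\<^sub>c y"
proof
  let ?x = "(1/2) *\<^sub>R (a + star a)" and ?y = "(- \<i>) *\<^sub>c (1/2) *\<^sub>R (a - star a)"
  show "star ?x = ?x"
    by (simp add: star_scaleR star_add star_star add.commute)
  show "star ?y = ?y"
    by (simp add: star_scale star_diff star_star scale_right_diff_distrib flip: scale_of_real)
  show "a = ?x + \<i> *\<^sub>c ?y"
    by (simp flip: scaleR_add_right add: scaleR_2[symmetric])
qed

text \<open>
  Both claims come from limits \<open>t \<rightarrow> 0\<close> in the curve identity.  The limit of the identity itself is
  \<open>- 2 i (S h)\<^sup>* = - 2 i S h\<close>.  Once \<open>S\<close> commutes with the involution, \<open>y + S v = S (v\<^sup>* + v)\<close> where \<open>i h\<close>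
  cancels and \<open>- 2 t S (z + z\<^sup>*)\<close> remains; the identity may then be divided by \<open>t\<close> again, and its limit is
  \<open>2 (2 i h) \<bullet> (- 2 i S h) = 4 S (h \<bullet> h)\<close>.
\<close>

lemma jordan_star_derivation_of_unitaries:
  assumes clin: "Vector_Spaces.linear scaleC scaleC S" and lin: "bounded_linear S"
    and unit: "S unit = 0"
    and unitary: "\<And>u. unitary u \<Longrightarrow> triple u (S u) u = - S u"
  shows "S (star a) = star (S a)" and "S (a \<bullet>\<^sub>J b) = S a \<bullet>\<^sub>J b + a \<bullet>\<^sub>J S b"
proof -
  interpret S: bounded_linear S by (rule lin)
  interpret J: bounded_bilinear jprod by (rule bounded_bilinear_jprod)
  interpret star: bounded_linear star by (rule bounded_linear_star)
  have S_scale: "S (c *\<^sub>c x) = c *\<^sub>c S x" for c x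
    using clin by (simp add: clinear_iff)
  define z where "z h t = h \<bullet>\<^sub>J (h \<bullet>\<^sub>J neumann (t *\<^sub>R (\<i> *\<^sub>c h)))" for h t
  define v where "v h t = (2 * \<i>) *\<^sub>c h - (2 * t) *\<^sub>R z h t" for h t
  define y where "y h t = star (S (v h t))" for h t
  define q where "q h t = 2 *\<^sub>R (v h t \<bullet>\<^sub>J (v h t \<bullet>\<^sub>J y h t)) - (v h t \<bullet>\<^sub>J v h t) \<bullet>\<^sub>J y h t" for h t
  have z_lim: "(z h \<longlongrightarrow> h \<bullet>\<^sub>J h) (at 0)" for h
    unfolding z_def
    using J.tendsto[OF tendsto_const J.tendsto[OF tendsto_const neumann_tendsto_unit]] by simp
  have v_lim: "(v h \<longlongrightarrow> (2 * \<i>) *\<^sub>c h) (at 0)" for h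
    unfolding v_def by (rule tendsto_eq_intros z_lim refl | simp)+
  have Sv_lim: "((\<lambda>t. S (v h t)) \<longlongrightarrow> (2 * \<i>) *\<^sub>c S h) (at 0)" for h
    using S.tendsto[OF v_lim] by (simp add: S_scale)
  have y_lim: "(y h \<longlongrightarrow> - (2 * \<i>) *\<^sub>c star (S h)) (at 0)" for h
    unfolding y_def using star.tendsto[OF Sv_lim] by (simp add: star_scale)
  define q0 where "q0 h = 2 *\<^sub>R (((2 * \<i>) *\<^sub>c h) \<bullet>\<^sub>J (((2 * \<i>) *\<^sub>c h) \<bullet>\<^sub>J (- (2 * \<i>) *\<^sub>c star (S h))))
      - (((2 * \<i>) *\<^sub>c h) \<bullet>\<^sub>J ((2 * \<i>) *\<^sub>c h)) \<bullet>\<^sub>J (- (2 * \<i>) *\<^sub>c star (S h))" for h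
  have q_lim: "(q h \<longlongrightarrow> q0 h) (at 0)" for h
    unfolding q_def q0_def
    by (intro tendsto_intros J.tendsto v_lim y_lim)
  have curve: "\<forall>\<^sub>F t in at 0. y h t + (2 * t) *\<^sub>R (v h t \<bullet>\<^sub>J y h t) + (t ^ 2) *\<^sub>R q h t = - S (v h t)"
    if "star h = h" for h
  proof -
    have zero: "((\<lambda>t. \<bar>t\<bar> * norm h) \<longlongrightarrow> 0) (at (0::real))"
      by (rule tendsto_eq_intros refl | simp)+
    have small: "\<forall>\<^sub>F t in at 0. \<bar>t\<bar> * norm h < 1 / 2"
      by (rule order_tendstoD[OF zero]) simp
    have nz: "\<forall>\<^sub>F t in at (0::real). t \<noteq> 0"
      by (simp add: eventually_at_filter)
    show ?thesis
      using small nz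
    proof eventually_elim
      case (elim t)
      show ?case
        unfolding q_def y_def v_def z_def
        by (rule unitary_curve_identity[OF lin unit unitary that _ elim(2)]) (use elim(1) in simp_all)
    qed
  qed
  \<comment> \<open>First order in \<open>t\<close>.\<close>
  have sa: "star (S h) = S h" if h: "star h = h" for h
  proof -
    have "((\<lambda>t. y h t + (2 * t) *\<^sub>R (v h t \<bullet>\<^sub>J y h t) + (t ^ 2) *\<^sub>R q h t)
        \<longlongrightarrow> - (2 * \<i>) *\<^sub>c star (S h)) (at 0)"
      by (rule tendsto_eq_intros J.tendsto v_lim y_lim q_lim refl | simp)+
    then have "((\<lambda>t. - S (v h t)) \<longlongrightarrow> - (2 * \<i>) *\<^sub>c star (S h)) (at 0)"
      by (rule Lim_transform_eventually[OF _ curve[OF h]])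
    moreover have "((\<lambda>t. - S (v h t)) \<longlongrightarrow> - ((2 * \<i>) *\<^sub>c S h)) (at 0)"
      by (rule tendsto_minus[OF Sv_lim])
    ultimately have "- (2 * \<i>) *\<^sub>c star (S h) = - ((2 * \<i>) *\<^sub>c S h)"
      by (rule tendsto_unique[rotated]) simp
    then have "(2 * \<i>) *\<^sub>c star (S h) = (2 * \<i>) *\<^sub>c S h"
      by (simp only: scale_minus_left neg_equal_iff_equal)
    then show ?thesis
      by (rule scale_left_imp_eq[rotated]) simp
  qed
  show star_comm: "S (star a) = star (S a)" for a
  proof -
    obtain x y where "star x = x" "star y = y" "a = x + \<i> *\<^sub>c y"
      by (rule self_adjoint_parts)
    then show ?thesis
      by (simp add: star_add star_scale S.add S_scale sa S.diff)
  qed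
  \<comment> \<open>Second order in \<open>t\<close>.\<close>
  have square: "S (h \<bullet>\<^sub>J h) = 2 *\<^sub>R (h \<bullet>\<^sub>J S h)" if h: "star h = h" for h
  proof -
    have "\<forall>\<^sub>F t in at 0. 2 *\<^sub>R (v h t \<bullet>\<^sub>J y h t) + t *\<^sub>R q h t = 2 *\<^sub>R S (z h t + star (z h t))"
      using curve[OF h] eventually_neq_at_within[of 0 0 UNIV]
    proof eventually_elim
      case (elim t)
      have "star (v h t) + v h t = - (2 * t) *\<^sub>R (z h t + star (z h t))"
        by (simp add: v_def star_diff star_scale star_scaleR h scaleR_add_right)
      then have "y h t + S (v h t) = S (- (2 * t) *\<^sub>R (z h t + star (z h t)))"
        by (simp only: y_def star_comm[symmetric] S.add[symmetric])
      also have "\<dots> = - (2 * t) *\<^sub>R S (z h t + star (z h t))"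
        by (rule S.scaleR)
      finally have sum: "y h t + S (v h t) = - (2 * t) *\<^sub>R S (z h t + star (z h t))" .
      have "(2 * t) *\<^sub>R (v h t \<bullet>\<^sub>J y h t) + (t ^ 2) *\<^sub>R q h t =
          (y h t + (2 * t) *\<^sub>R (v h t \<bullet>\<^sub>J y h t) + (t ^ 2) *\<^sub>R q h t) - y h t"
        by simp
      also have "\<dots> = - (y h t + S (v h t))"
        by (simp only: elim(1)) simp
      also have "\<dots> = (2 * t) *\<^sub>R S (z h t + star (z h t))"
        by (simp only: sum) simp
      finally have "t *\<^sub>R (2 *\<^sub>R (v h t \<bullet>\<^sub>J y h t) + t *\<^sub>R q h t) = t *\<^sub>R (2 *\<^sub>R S (z h t + star (z h t)))"
        by (simp add: scaleR_add_right power2_eq_square mult.commute)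
      then show ?case
        by (rule real_vector.scale_left_imp_eq[OF elim(2)])
    qed
    moreover have "((\<lambda>t. 2 *\<^sub>R (v h t \<bullet>\<^sub>J y h t) + t *\<^sub>R q h t)
        \<longlongrightarrow> 2 *\<^sub>R (((2 * \<i>) *\<^sub>c h) \<bullet>\<^sub>J (- (2 * \<i>) *\<^sub>c S h))) (at 0)"
      by (rule tendsto_eq_intros J.tendsto v_lim y_lim[of h, unfolded sa[OF h]] q_lim refl | simp)+
    ultimately have "((\<lambda>t. 2 *\<^sub>R S (z h t + star (z h t)))
        \<longlongrightarrow> 2 *\<^sub>R (((2 * \<i>) *\<^sub>c h) \<bullet>\<^sub>J (- (2 * \<i>) *\<^sub>c S h))) (at 0)"
      by (rule Lim_transform_eventually[rotated])
    moreover have "((\<lambda>t. 2 *\<^sub>R S (z h t + star (z h t)))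
        \<longlongrightarrow> 2 *\<^sub>R S (h \<bullet>\<^sub>J h + star (h \<bullet>\<^sub>J h))) (at 0)"
      by (intro tendsto_intros S.tendsto star.tendsto z_lim)
    ultimately have eq: "2 *\<^sub>R (((2 * \<i>) *\<^sub>c h) \<bullet>\<^sub>J (- (2 * \<i>) *\<^sub>c S h)) =
        2 *\<^sub>R S (h \<bullet>\<^sub>J h + star (h \<bullet>\<^sub>J h))"
      by (rule tendsto_unique[rotated]) simp
    have left: "((2 * \<i>) *\<^sub>c h) \<bullet>\<^sub>J (- (2 * \<i>) *\<^sub>c S h) = 2 *\<^sub>R (2 *\<^sub>R (h \<bullet>\<^sub>J S h))"
      by (simp add: jprod_simps flip: scale_of_real)
    have right: "S (h \<bullet>\<^sub>J h + star (h \<bullet>\<^sub>J h)) = 2 *\<^sub>R S (h \<bullet>\<^sub>J h)"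
      by (simp add: star_jprod h S.add scaleR_2)
    have "2 *\<^sub>R (h \<bullet>\<^sub>J S h) = S (h \<bullet>\<^sub>J h)"
      using eq unfolding left right by (simp only: scaleR_cancel_left) simp
    then show ?thesis
      by (rule sym)
  qed
  have leibniz: "S (h \<bullet>\<^sub>J k) = S h \<bullet>\<^sub>J k + h \<bullet>\<^sub>J S k" if "star h = h" "star k = k" for h k
  proof -
    have "S ((h + k) \<bullet>\<^sub>J (h + k)) = 2 *\<^sub>R ((h + k) \<bullet>\<^sub>J S (h + k))"
      by (rule square) (simp add: star_add that)
    then have "2 *\<^sub>R S (h \<bullet>\<^sub>J k) = 2 *\<^sub>R (S h \<bullet>\<^sub>J k + h \<bullet>\<^sub>J S k)"
      by (simp add: J.add_left J.add_right S.add square that jprod_commute[of k h]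
          scaleR_add_right scaleR_2 jprod_commute[of "S h" k])
    then show ?thesis by simp
  qed
  obtain x y where a: "star x = x" "star y = y" "a = x + \<i> *\<^sub>c y"
    by (rule self_adjoint_parts)
  obtain x' y' where b: "star x' = x'" "star y' = y'" "b = x' + \<i> *\<^sub>c y'"
    by (rule self_adjoint_parts)
  show "S (a \<bullet>\<^sub>J b) = S a \<bullet>\<^sub>J b + a \<bullet>\<^sub>J S b"
    by (simp add: a b jprod_simps S.add S_scale leibniz scale_right_distrib S.diff)
qed

lemma jordan_star_derivation_imp_triple_derivation:
  assumes "Vector_Spaces.linear scaleC scaleC S"
    and star: "\<And>a. S (star a) = star (S a)"
    and leibniz: "\<And>a b. S (a \<bullet>\<^sub>J b) = S a \<bullet>\<^sub>J b + a \<bullet>\<^sub>J S b"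
  shows "triple_derivation scaleC jprod star S"
proof -
  interpret S: Vector_Spaces.linear scaleC scaleC S by (rule assms(1))
  show ?thesis
    unfolding triple_derivation_def triple_product_def
    by (simp add: assms(1) S.add S.diff leibniz star jprod_add_left jprod_add_right)
qed

lemma triple_derivation_add:
  assumes "triple_derivation scaleC jprod star S" and "triple_derivation scaleC jprod star R"
  shows "triple_derivation scaleC jprod star (\<lambda>x. S x + R x)"
proof -
  have "Vector_Spaces.linear scaleC scaleC (\<lambda>x. S x + R x)"
    using assms by (simp add: triple_derivation_def clinear_iff scale_right_distrib)
  then show ?thesis
    using assms unfolding triple_derivation_def triple_product_def
    by (simp add: jprod_add_left jprod_add_right star_add)
qed

text \<open>Here the identity for unitaries is used at the unit.\<close>

lemma triple_derivation_unit_skew: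
  assumes "triple_derivation scaleC jprod star \<delta>"
  shows "star (\<delta> unit) = - \<delta> unit"
proof -
  have "unitary unit"
    by (simp add: unitary_def op_commute_def)
  from triple_derivation_unitary[OF assms this] show ?thesis
    by (simp add: triple_product_def)
qed

lemma local_triple_derivation_imp_triple_derivation:
  assumes "local_triple_derivation scaleC jprod star T"
  shows "triple_derivation scaleC jprod star T"
proof -
  interpret J: bounded_bilinear jprod by (rule bounded_bilinear_jprod)
  have T: "Vector_Spaces.linear scaleC scaleC T" "bounded_linear T"
    and local: "\<exists>\<delta>. triple_derivation scaleC jprod star \<delta> \<and> T a = \<delta> a" for a
    using assms by (simp_all add: local_triple_derivation_def)
  have skew: "star (T unit) = - T unit"
    using local[of unit] triple_derivation_unit_skew by metis
  define M where "M = jprod (T unit)"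
  have M: "triple_derivation scaleC jprod star M"
    unfolding M_def using skew by (rule skew_multiplication_triple_derivation)
  define S where "S x = T x - M x" for x
  have unitary: "triple u (S u) u = - S u" if "unitary u" for u
  proof -
    have "triple u (T u) u = - T u"
      using local[of u] triple_derivation_unitary that by metis
    moreover have "triple u (M u) u = - M u"
      using M that by (rule triple_derivation_unitary)
    moreover have "triple u (S u) u = triple u (T u) u - triple u (M u) u"
      by (simp add: S_def triple_product_def star_diff jprod_diff_left jprod_diff_right)
    ultimately show ?thesis
      by (simp add: S_def)
  qed
  have clin: "Vector_Spaces.linear scaleC scaleC S"
    using T(1) M
    by (simp add: S_def triple_derivation_def clinear_iff scale_right_diff_distrib)
  have lin: "bounded_linear S"
    unfolding S_def M_def by (intro bounded_linear_sub T(2) J.bounded_linear_right)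
  have unit: "S unit = 0"
    by (simp add: S_def M_def)
  have "triple_derivation scaleC jprod star S"
    using clin jordan_star_derivation_of_unitaries[OF clin lin unit unitary]
    by (rule jordan_star_derivation_imp_triple_derivation)
  from triple_derivation_add[OF this M] show ?thesis
    by (simp add: S_def)
qed

end

theorem theorem15:
  fixes scaleC :: "complex \<Rightarrow> 'a::banach \<Rightarrow> 'a"
    and jprod :: "'a \<Rightarrow> 'a \<Rightarrow> 'a"
    and star :: "'a \<Rightarrow> 'a"
    and unit :: 'a
    and T :: "'a \<Rightarrow> 'a"
  assumes "unital_jb_star_algebra scaleC jprod star unit"
    and "local_triple_derivation scaleC jprod star T"
  shows "triple_derivation scaleC jprod star T"
  using assms by (rule unital_jb_star_algebra.local_triple_derivation_imp_triple_derivation)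

end
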